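(* Let $d \ge 1$, let $D_0, D_p, u \in \mathbb{R}^d$ and let $\lambda \ge 0$. Put $\bar{D} = \tfrac{1}{2}(D_0 + D_p)$ and $\delta = \tfrac{1}{2}(D_0 - D_p)$. Then $$\tfrac{1}{2}\bigl(\lVert D_0 - u\rVert^2 + \lVert D_p - u\rVert^2\bigr) + \lambda \lVert D_0 - D_p\rVert^2 = \lVert \bar{D} - u\rVert^2 + (1 + 4\lambda)\lVert \delta \rVert^2 .$$
   Context: $\lVert\cdot\rVert$ is the Euclidean norm on $\mathbb{R}^d$. $D_0$ and $D_p$ are the predictions of a model on two branches (a nominal view $0$ and a perturbed view $p$), $u$ is the target common to both branches, and $\lambda$ is the weight of the penalty on disagreement between the two predictions. *)

theory Defs
  imports "HOL-Analysis.Analysis"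
begin

end

theory Submission
  imports Defs
begin

text \<open>Since \<open>D\<^sub>0 - u\<close> and \<open>D\<^sub>p - u\<close> are
  \<open>(Dbar - u) + \<delta>\<close> and \<open>(Dbar - u) - \<delta>\<close>, the parallelogram
  law turns their mean square into the squares of \<open>Dbar - u\<close> and
  \<open>\<delta>\<close>; the factor 4 comes from
  \<open>D\<^sub>0 - D\<^sub>p = 2 *\<^sub>R \<delta>\<close>.\<close>

theorem lemma1:
  fixes D\<^sub>0 D\<^sub>p u :: "real ^ 'd"
    and lam :: real
  assumes "lam \<ge> 0"
  shows "let Dbar = (1/2) *\<^sub>R (D\<^sub>0 + D\<^sub>p); \<delta> = (1/2) *\<^sub>R (D\<^sub>0 - D\<^sub>p) in
    (1/2) * ((norm (D\<^sub>0 - u))\<^sup>2 + (norm (D\<^sub>p - u))\<^sup>2) + lam * (norm (D\<^sub>0 - D\<^sub>p))\<^sup>2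
      = (norm (Dbar - u))\<^sup>2 + (1 + 4 * lam) * (norm \<delta>)\<^sup>2"
  \<comment> \<open>With squared norms as inner products, bilinearity and symmetry leave a
    polynomial identity in \<open>lam\<close> and the pairwise inner products of the three
    vectors.\<close>
  unfolding Let_def power2_norm_eq_inner
  by (simp add: inner_add_left inner_add_right inner_diff_left inner_diff_right
      inner_commute field_simps)

end
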